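(* For all $p\in[1,\infty)$ and all $d\in\mathbb{N}$, $d\geq 1$, one has $m(\ell_p^d)\leq d+1$.
   Context: $\ell_p^d$ is $\mathbb{R}^d$ with the norm $\|x\|_p=\left(\sum_{n=1}^d|x^{(n)}|^p\right)^{1/p}$. A subset $A$ of a real normed space $X$ is $\lambda$-equilateral if $\|x-y\|=\lambda$ for all distinct $x,y\in A$; $A$ is equilateral if it is $\lambda$-equilateral for some $\lambda>0$. An equilateral set $A\subseteq X$ is maximal if there is no equilateral set $A'\subseteq X$ with $A\subsetneq A'$. $m(X)$ denotes the minimum cardinality of a maximal equilateral set in $X$. *)

theory Defs
  imports "HOL-Analysis.Analysis"
begin

text \<open>
  The type \<^typ>\<open>real ^ 'n\<close> already carries the Euclidean norm as its type-class norm, so a different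
  norm on it cannot be a class instance. The notions below therefore take the norm
  \<open>N\<close> of the space \<open>X = ('a, N)\<close> as an explicit argument.
\<close>

definition lp_norm :: "real \<Rightarrow> real ^ 'n::finite \<Rightarrow> real" where
  "lp_norm p x = (\<Sum>i\<in>UNIV. \<bar>x $ i\<bar> powr p) powr (1 / p)"

definition lambda_equilateral :: "('a::real_vector \<Rightarrow> real) \<Rightarrow> real \<Rightarrow> 'a set \<Rightarrow> bool" where
  "lambda_equilateral N l A \<longleftrightarrow> (\<forall>x\<in>A. \<forall>y\<in>A. x \<noteq> y \<longrightarrow> N (x - y) = l)"

definition equilateral :: "('a::real_vector \<Rightarrow> real) \<Rightarrow> 'a set \<Rightarrow> bool" where
  "equilateral N A \<longleftrightarrow> (\<exists>l>0. lambda_equilateral N l A)"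

definition maximal_equilateral :: "('a::real_vector \<Rightarrow> real) \<Rightarrow> 'a set \<Rightarrow> bool" where
  "maximal_equilateral N A \<longleftrightarrow> equilateral N A \<and> \<not> (\<exists>A'. equilateral N A' \<and> A \<subset> A')"

text \<open>\<^const>\<open>card\<close> is \<open>0\<close> on infinite sets, which would spoil a minimum of cardinalities.\<close>

definition ecard :: "'a set \<Rightarrow> enat" where
  "ecard A = (if finite A then enat (card A) else \<infinity>)"

text \<open>
  Since \<^typ>\<open>enat\<close> is well-ordered, the infimum is attained whenever a maximal equilateral set exists;
  if there were none, it would be \<open>\<infinity>\<close>.
\<close>

definition min_maximal_equilateral :: "('a::real_vector \<Rightarrow> real) \<Rightarrow> enat" where
  "min_maximal_equilateral N = (INF A\<in>{A. maximal_equilateral N A}. ecard A)"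

end

theory Submission
  imports Defs
begin

text \<open>
  Let \<open>d\<close> be the dimension and let \<open>u > 0\<close> solve \<open>(1 + u)\<^sup>p + (d - 1) u\<^sup>p = 2\<close>. The claim is that
  the \<open>d + 1\<close> points \<open>e\<^sub>1, \<dots>, e\<^sub>d\<close> and \<open>c = (-u, \<dots>, -u)\<close> form a maximal equilateral set. All their
  mutual distances are \<open>2\<^bsup>1/p\<^esup>\<close>: for \<open>e\<^sub>i\<close> and \<open>c\<close> this is the equation for \<open>u\<close>, which has a solution by
  the intermediate value theorem. Since there are at least two points, every equilateral superset
  has the same distance, so it remains to see that no further point \<open>x\<close> is at distance
  \<open>2\<^bsup>1/p\<^esup>\<close> from all of them. The distance from \<open>x\<close> to \<open>e\<^sub>i\<close> depends on \<open>i\<close> only through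
  \<open>h(x\<^sub>i)\<close>, where \<open>h(t) = |1 - t|\<^sup>p - |t|\<^sup>p\<close>.

  For \<open>p > 1\<close> the function \<open>h\<close> is strictly decreasing (\<open>diagonal_distance_inj\<close>), so \<open>x = (t, \<dots>, t)\<close>.
  The solution \<open>t = -u\<close> is the only one with \<open>t \<le> 0\<close>, and a solution \<open>t = v > 0\<close> is too far from
  \<open>c\<close>: \<open>d (u + v)\<^sup>p > 2\<close>. This inequality (\<open>diagonal_gap\<close>) is the heart of the proof. The equations
  for \<open>u\<close> and \<open>v\<close> give \<open>d v\<^sup>p = 2 - A\<close> and \<open>d u\<^sup>p = 2 - B\<close> with \<open>A = |1 - v|\<^sup>p - v\<^sup>p\<close> and
  \<open>B = (1 + u)\<^sup>p - u\<^sup>p > 1\<close>. If \<open>v \<ge> 1/2\<close>, then \<open>A \<le> 0\<close> and \<open>d v\<^sup>p\<close> is already at least \<open>2\<close>. Otherwise \<open>A < 1 < B\<close> and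
  hence \<open>u < v\<close>. For \<open>p \<le> 2\<close>, the bounds \<open>B \<le> 1 + p u\<close> and \<open>A \<le> 1 - p v\<close> give
  \<open>A + B < 2\<close>, and \<open>(u + v)\<^sup>p \<ge> u\<^sup>p + v\<^sup>p\<close> suffices. For \<open>p > 2\<close> the stronger bound
  \<open>(u + v)\<^sup>p \<ge> u\<^sup>p + v\<^sup>p + p u v\<^bsup>p-1\<^esup>\<close> has a cross term which, multiplied by \<open>d\<close>, is at least
  \<open>2 p u\<close> and so exceeds \<open>B - 1\<close>.

  For \<open>p = 1\<close> the function \<open>h\<close> is constant on either side of \<open>[0, 1]\<close> and \<open>x\<close> need not be diagonal; but then
  \<open>u = 1/d\<close>, and equality in the triangle inequality leads to a contradiction
  (\<open>no_extension_p1\<close>).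
\<close>

section \<open>Inequalities for real powers\<close>

lemma powr_superadditive:
  fixes x y q :: real
  assumes "0 \<le> x" "0 \<le> y" "1 \<le> q"
  shows "x powr q + y powr q \<le> (x + y) powr q"
proof (cases "x + y = 0")
  case True
  then have "x = 0" "y = 0" using assms by auto
  then show ?thesis by simp
next
  case False
  define s where "s = x + y"
  have s: "s > 0" using False assms by (simp add: s_def)
  \<comment> \<open>A fraction \<open>a / s\<close> in \<open>[0, 1]\<close> can only shrink when raised to the power \<open>q \<ge> 1\<close>.\<close>
  have part: "a powr q \<le> a / s * s powr q" if "0 \<le> a" "a \<le> s" for a
  proof -
    have "(a / s) powr q \<le> (a / s) powr 1"
      using that s assms by (intro powr_mono') auto
    then have "(a / s) powr q * s powr q \<le> a / s * s powr q"
      using that s by (intro mult_right_mono) auto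
    then show ?thesis using that s by (simp add: powr_divide)
  qed
  have "x powr q + y powr q \<le> x / s * s powr q + y / s * s powr q"
    using assms by (intro add_mono part) (auto simp: s_def)
  also have "\<dots> = (x / s + y / s) * s powr q" by (simp add: distrib_right)
  also have "x / s + y / s = 1" using s by (simp add: s_def flip: add_divide_distrib)
  finally show ?thesis by (simp add: s_def)
qed

lemma powr_subadditive:
  fixes x y q :: real
  assumes "0 \<le> x" "0 \<le> y" "0 \<le> q" "q \<le> 1"
  shows "(x + y) powr q \<le> x powr q + y powr q"
proof (cases "x + y = 0")
  case True
  then have "x = 0" "y = 0" using assms by auto
  then show ?thesis by simp
next
  case False
  define s where "s = x + y"
  have s: "s > 0" using False assms by (simp add: s_def)
  have part: "a / s * s powr q \<le> a powr q" if "0 \<le> a" "a \<le> s" for a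
  proof -
    have "(a / s) powr 1 \<le> (a / s) powr q"
      using that s assms by (intro powr_mono') auto
    then have "a / s * s powr q \<le> (a / s) powr q * s powr q"
      using that s by (intro mult_right_mono) auto
    then show ?thesis using that s by (simp add: powr_divide)
  qed
  have "x / s + y / s = 1" using s by (simp add: s_def flip: add_divide_distrib)
  then have "(x + y) powr q = (x / s + y / s) * s powr q" by (simp add: s_def)
  also have "\<dots> = x / s * s powr q + y / s * s powr q" by (simp add: distrib_right)
  also have "\<dots> \<le> x powr q + y powr q"
    using assms by (intro add_mono part) (auto simp: s_def)
  finally show ?thesis .
qed

text \<open>
  Strict convexity of \<open>x \<mapsto> x\<^sup>p\<close>, in the form in which it controls the function \<open>h\<close> on the negative axis.
\<close>

lemma powr_increment_strict_mono:
  fixes s t p :: real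
  assumes "1 < p" "0 \<le> s" "s < t"
  shows "(1 + s) powr p - s powr p < (1 + t) powr p - t powr p"
proof (rule DERIV_pos_imp_increasing_open[OF \<open>s < t\<close>])
  fix x assume x: "s < x" "x < t"
  have "((\<lambda>x. (1 + x) powr p - x powr p) has_real_derivative
          p * (1 + x) powr (p - 1) - p * x powr (p - 1)) (at x)"
    using x assms by (auto intro!: derivative_eq_intros)
  moreover have "x powr (p - 1) < (1 + x) powr (p - 1)"
    using x assms by (intro powr_less_mono2) auto
  ultimately show "\<exists>y. ((\<lambda>x. (1 + x) powr p - x powr p) has_real_derivative y) (at x) \<and> 0 < y"
    using assms by (auto intro!: exI)
next
  show "continuous_on {s..t} (\<lambda>x. (1 + x) powr p - x powr p)"
    using assms by (intro continuous_on_powr' continuous_on_add continuous_on_diff continuous_on_mult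
        continuous_on_const continuous_on_id) auto
qed

text \<open>
  This and the next two bounds are equalities at \<open>0\<close>, and differentiating reduces them to the fact that
  \<open>x \<mapsto> x\<^bsup>p-1\<^esup>\<close> is subadditive for \<open>p \<le> 2\<close> and superadditive for \<open>p \<ge> 2\<close>.
\<close>

lemma powr_increment_le:
  fixes u p :: real
  assumes "1 \<le> p" "p \<le> 2" "0 \<le> u"
  shows "(1 + u) powr p \<le> 1 + p * u + u powr p"
proof -
  let ?g = "\<lambda>x. 1 + p * x + x powr p - (1 + x) powr p"
  have "?g 0 \<le> ?g u"
  proof (rule DERIV_nonneg_imp_increasing_open[OF \<open>0 \<le> u\<close>])
    fix x assume x: "0 < x" "x < u"
    have "(?g has_real_derivative p + p * x powr (p - 1) - p * (1 + x) powr (p - 1)) (at x)"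
      using x by (auto intro!: derivative_eq_intros)
    moreover have "(1 + x) powr (p - 1) \<le> 1 powr (p - 1) + x powr (p - 1)"
      using x assms by (intro powr_subadditive) auto
    then have "p * (1 + x) powr (p - 1) \<le> p * (1 + x powr (p - 1))"
      using assms by (intro mult_left_mono) auto
    ultimately show "\<exists>y. (?g has_real_derivative y) (at x) \<and> 0 \<le> y"
      by (force simp: algebra_simps)
  next
    show "continuous_on {0..u} ?g"
      using assms by (intro continuous_on_powr' continuous_on_add continuous_on_diff continuous_on_mult
        continuous_on_const continuous_on_id) auto
  qed
  then show ?thesis by simp
qed

lemma powr_increment_ge:
  fixes u p :: real
  assumes "2 \<le> p" "0 \<le> u"
  shows "1 + p * u + u powr p \<le> (1 + u) powr p"
proof -
  let ?g = "\<lambda>x. (1 + x) powr p - (1 + p * x + x powr p)"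
  have "?g 0 \<le> ?g u"
  proof (rule DERIV_nonneg_imp_increasing_open[OF \<open>0 \<le> u\<close>])
    fix x assume x: "0 < x" "x < u"
    have "(?g has_real_derivative p * (1 + x) powr (p - 1) - (p + p * x powr (p - 1))) (at x)"
      using x by (auto intro!: derivative_eq_intros)
    moreover have "1 powr (p - 1) + x powr (p - 1) \<le> (1 + x) powr (p - 1)"
      using x assms by (intro powr_superadditive) auto
    then have "p * (1 + x powr (p - 1)) \<le> p * (1 + x) powr (p - 1)"
      using assms by (intro mult_left_mono) auto
    ultimately show "\<exists>y. (?g has_real_derivative y) (at x) \<and> 0 \<le> y"
      by (force simp: algebra_simps)
  next
    show "continuous_on {0..u} ?g"
      using assms by (intro continuous_on_powr' continuous_on_add continuous_on_diff continuous_on_mult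
        continuous_on_const continuous_on_id) auto
  qed
  then show ?thesis by simp
qed

lemma powr_decrement_le:
  fixes v p :: real
  assumes "1 \<le> p" "p \<le> 2" "0 \<le> v" "v \<le> 1"
  shows "(1 - v) powr p \<le> 1 - p * v + v powr p"
proof -
  let ?g = "\<lambda>x. 1 - p * x + x powr p - (1 - x) powr p"
  have "?g 0 \<le> ?g v"
  proof (rule DERIV_nonneg_imp_increasing_open[OF \<open>0 \<le> v\<close>])
    fix x assume x: "0 < x" "x < v"
    have "(?g has_real_derivative p * x powr (p - 1) + p * (1 - x) powr (p - 1) - p) (at x)"
      using x assms by (auto intro!: derivative_eq_intros)
    moreover have "(x + (1 - x)) powr (p - 1) \<le> x powr (p - 1) + (1 - x) powr (p - 1)"
      using x assms by (intro powr_subadditive) auto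
    then have "p * 1 \<le> p * (x powr (p - 1) + (1 - x) powr (p - 1))"
      using assms by (intro mult_left_mono) auto
    ultimately show "\<exists>y. (?g has_real_derivative y) (at x) \<and> 0 \<le> y"
      by (force simp: algebra_simps)
  next
    show "continuous_on {0..v} ?g"
      using assms by (intro continuous_on_powr' continuous_on_add continuous_on_diff continuous_on_mult
        continuous_on_const continuous_on_id) auto
  qed
  then show ?thesis by simp
qed

text \<open>
  By convexity the chord slope is at most the slope \<open>p (1 + u)\<^bsup>p-1\<^esup>\<close> at the right end; the exponent is
  then relaxed to \<open>p\<close>, since \<open>(1 + u)\<^sup>p\<close> is the quantity bounded by the equation for \<open>u\<close>.
\<close>

lemma powr_tangent_le:
  fixes u p :: real
  assumes "1 \<le> p" "0 \<le> u"
  shows "(1 + u) powr p - 1 \<le> p * u * (1 + u) powr p"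
proof (cases "u = 0")
  case False
  then have "1 < 1 + u" using assms by simp
  moreover have "\<And>x. 1 \<le> x \<Longrightarrow> ((\<lambda>x. x powr p) has_real_derivative p * x powr (p - 1)) (at x)"
    by (auto intro!: derivative_eq_intros)
  ultimately obtain z where z: "1 < z" "z < 1 + u"
    "(1 + u) powr p - 1 powr p = (1 + u - 1) * (p * z powr (p - 1))"
    using MVT2[of 1 "1 + u" "\<lambda>x. x powr p" "\<lambda>x. p * x powr (p - 1)"] by blast
  have "z powr (p - 1) \<le> (1 + u) powr (p - 1)"
    using z assms by (intro powr_mono2) auto
  also have "\<dots> \<le> (1 + u) powr p"
    using assms by (intro powr_mono) auto
  finally have "u * p * z powr (p - 1) \<le> u * p * (1 + u) powr p"
    using assms by (intro mult_left_mono) auto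
  then show ?thesis using z by (simp add: mult_ac)
qed auto

section \<open>Points on the diagonal\<close>

text \<open>
  The two equations say that \<open>(-u, \<dots>, -u)\<close> and \<open>(v, \<dots>, v)\<close> are at distance \<open>2\<^bsup>1/p\<^esup>\<close> from every
  \<open>e\<^sub>i\<close>; the conclusion says that they are farther than \<open>2\<^bsup>1/p\<^esup>\<close> from each other.
\<close>

lemma diagonal_gap:
  fixes u v p d :: real
  assumes p: "1 < p" and d: "1 \<le> d" and u: "0 < u" and v: "0 < v"
    and fu: "(1 + u) powr p + (d - 1) * u powr p = 2"
    and fv: "\<bar>1 - v\<bar> powr p + (d - 1) * v powr p = 2"
  shows "2 < d * (u + v) powr p"
proof (cases "1 / 2 \<le> v")
  case True
  \<comment> \<open>\<open>v\<close> is at least as far from \<open>0\<close> as from \<open>1\<close>, so \<open>(v, \<dots>, v)\<close> alone has norm at least \<open>2\<^bsup>1/p\<^esup>\<close>.\<close>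
  have "\<bar>1 - v\<bar> powr p \<le> v powr p"
    using True p by (intro powr_mono2) auto
  then have "2 \<le> d * v powr p" using fv by (simp add: algebra_simps)
  also have "\<dots> < d * (u + v) powr p"
    using u v p d by (intro mult_strict_left_mono powr_less_mono2) auto
  finally show ?thesis .
next
  case False
  define A where "A = (1 - v) powr p - v powr p"
  define B where "B = (1 + u) powr p - u powr p"
  have dv: "d * v powr p = 2 - A" and du: "d * u powr p = 2 - B"
    using fu fv False by (auto simp: A_def B_def algebra_simps)
  have "(1 - v) powr p \<le> 1 powr p" using False v p by (intro powr_mono2) auto
  then have "(1 - v) powr p \<le> 1" by simp
  moreover have "0 < v powr p" using v by simp
  ultimately have A1: "A < 1" unfolding A_def by linarith
  have B1: "1 < B"
    using powr_increment_strict_mono[OF p order.refl u] by (simp add: B_def)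
  have "d * u powr p < d * v powr p" using A1 B1 dv du by simp
  then have "u powr p < v powr p" using d by simp
  then have uv: "u < v" using p u v powr_mono2[of p v u] by (cases "u < v") auto
  show ?thesis
  proof (cases "p \<le> 2")
    case True
    have "B \<le> 1 + p * u"
      using powr_increment_le[of p u] True p u by (simp add: B_def)
    moreover have "A \<le> 1 - p * v"
      using powr_decrement_le[of p v] True p v False by (simp add: A_def)
    moreover have "p * u < p * v" using uv p by simp
    ultimately have "A + B < 2" by simp
    moreover have "d * (u powr p + v powr p) \<le> d * (u + v) powr p"
      using d u v p by (intro mult_left_mono powr_superadditive) auto
    ultimately show ?thesis using dv du by (simp add: distrib_left)
  next
    case p2: False
    have "1 + p * (u / v) + (u / v) powr p \<le> (1 + u / v) powr p"
      using p2 u v by (intro powr_increment_ge) auto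
    then have "v powr p * (1 + p * (u / v) + (u / v) powr p) \<le> v powr p * (1 + u / v) powr p"
      by (intro mult_left_mono) auto
    also have "\<dots> = (v * (1 + u / v)) powr p" using u v by (simp add: powr_mult)
    also have "v * (1 + u / v) = u + v" using v by (simp add: field_simps)
    finally have "v powr p + p * (u / v) * v powr p + u powr p \<le> (u + v) powr p"
      using u v by (simp add: powr_divide algebra_simps)
    then have "d * (v powr p + p * (u / v) * v powr p + u powr p) \<le> d * (u + v) powr p"
      using d by (intro mult_left_mono) auto
    then have sum: "(2 - A) + p * (u / v) * (2 - A) + (2 - B) \<le> d * (u + v) powr p"
    proof -
      have "d * (v powr p + p * (u / v) * v powr p + u powr p)
          = d * v powr p + p * (u / v) * (d * v powr p) + d * u powr p"
        by (simp add: distrib_left mult_ac)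
      also have "\<dots> = (2 - A) + p * (u / v) * (2 - A) + (2 - B)"
        by (simp only: dv du)
      finally show ?thesis using \<open>d * (v powr p + _ + u powr p) \<le> _\<close> by simp
    qed
    \<comment> \<open>The cross term is at least \<open>p u / v\<close>, as \<open>A < 1\<close>, and \<open>1 / v > 2\<close>.\<close>
    have pos: "0 \<le> p * (u / v)" using p u v by simp
    have "p * u * 2 \<le> p * u * (1 / v)"
      using False p u v by (intro mult_left_mono) (auto simp: field_simps)
    also have "\<dots> = p * (u / v) * 1" by simp
    also have "\<dots> \<le> p * (u / v) * (2 - A)"
      using A1 pos by (intro mult_left_mono) auto
    finally have cross: "2 * (p * u) \<le> p * (u / v) * (2 - A)" by simp
    \<comment> \<open>The equation for \<open>u\<close> bounds \<open>(1 + u)\<^sup>p\<close>, which makes the convexity bound on \<open>B - 1\<close> linear in \<open>u\<close>.\<close>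
    have "(1 + u) powr p \<le> 2" using fu d by (smt (verit) mult_nonneg_nonneg powr_ge_zero)
    then have "p * u * (1 + u) powr p \<le> p * u * 2"
      using p u by (intro mult_left_mono) auto
    moreover have "0 < u powr p" using u by simp
    moreover have "(1 + u) powr p - 1 \<le> p * u * (1 + u) powr p"
      using p u by (intro powr_tangent_le) auto
    ultimately have "B - 1 < 2 * (p * u)"
      unfolding B_def by linarith
    then show ?thesis using sum cross A1 by simp
  qed
qed

text \<open>
  The function is strictly decreasing: on \<open>(-\<infinity>, 0]\<close> by strict convexity, on \<open>[0, 1]\<close> since both
  terms are monotone, and on \<open>[1, \<infinity>)\<close> by the point symmetry \<open>h (1 - t) = - h t\<close>.
\<close>

lemma diagonal_distance_inj:
  fixes s t p :: real
  assumes p: "1 < p"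
    and eq: "\<bar>1 - s\<bar> powr p - \<bar>s\<bar> powr p = \<bar>1 - t\<bar> powr p - \<bar>t\<bar> powr p"
  shows "s = t"
proof -
  let ?h = "\<lambda>t::real. \<bar>1 - t\<bar> powr p - \<bar>t\<bar> powr p"
  have neg: "?h t < ?h s" if "s < t" "t \<le> 0" for s t
    using powr_increment_strict_mono[OF p, of "- t" "- s"] that by simp
  have reflect: "?h (1 - t) = - ?h t" for t by simp
  have pos: "?h t < ?h s" if "s < t" "1 \<le> s" for s t
    using neg[of "1 - t" "1 - s"] that by simp
  have mid: "?h t < ?h s" if "s < t" "0 \<le> s" "t \<le> 1" for s t
  proof -
    have "(1 - t) powr p < (1 - s) powr p" "s powr p < t powr p"
      using that p by (auto intro!: powr_less_mono2)
    then show ?thesis using that by simp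
  qed
  define h where "h = ?h"
  have le1: "h t < h s" if "s < t" "t \<le> 1" for s t
  proof (cases "t \<le> 0")
    case True
    then show ?thesis using neg that by (simp add: h_def)
  next
    case False
    show ?thesis
    proof (cases "0 \<le> s")
      case True
      then show ?thesis using mid that by (simp add: h_def)
    next
      case s: False
      have "h t < h 0" using mid[of 0 t] False that by (simp add: h_def)
      also have "h 0 < h s" using neg[of s 0] s by (simp add: h_def)
      finally show ?thesis .
    qed
  qed
  have less: "h t < h s" if "s < t" for s t
  proof (cases "t \<le> 1")
    case True
    then show ?thesis using le1 that by blast
  next
    case False
    show ?thesis
    proof (cases "1 \<le> s")
      case True
      then show ?thesis using pos that by (simp add: h_def)
    next
      case s: False
      have "h t < h 1" using pos[of 1 t] False by (simp add: h_def)
      also have "h 1 < h s" using le1[of s 1] s by simp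
      finally show ?thesis .
    qed
  qed
  have "h s = h t" using eq by (simp add: h_def)
  then show ?thesis using less[of s t] less[of t s] by (cases s t rule: linorder_cases) auto
qed

section \<open>Maximality of the simplex with a diagonal apex\<close>

lemma lp_norm_eq_iff:
  assumes "1 \<le> p"
  shows "lp_norm p x = 2 powr (1 / p) \<longleftrightarrow> (\<Sum>i\<in>UNIV. \<bar>x $ i\<bar> powr p) = 2"
proof
  assume "lp_norm p x = 2 powr (1 / p)"
  then have "((\<Sum>i\<in>UNIV. \<bar>x $ i\<bar> powr p) powr (1 / p)) powr p = (2 powr (1 / p)) powr p"
    by (simp add: lp_norm_def)
  then show "(\<Sum>i\<in>UNIV. \<bar>x $ i\<bar> powr p) = 2"
    using assms by (simp add: powr_powr sum_nonneg)
qed (simp add: lp_norm_def)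

lemma sum_powr_axis_diff:
  fixes x :: "real ^ 'n::finite"
  shows "(\<Sum>k\<in>UNIV. \<bar>(axis i 1 - x) $ k\<bar> powr p)
    = \<bar>1 - x $ i\<bar> powr p - \<bar>x $ i\<bar> powr p + (\<Sum>k\<in>UNIV. \<bar>x $ k\<bar> powr p)"
proof -
  have "(\<Sum>k\<in>UNIV. \<bar>(axis i 1 - x) $ k\<bar> powr p)
      = \<bar>1 - x $ i\<bar> powr p + (\<Sum>k\<in>UNIV - {i}. \<bar>x $ k\<bar> powr p)"
    by (subst sum.remove[of _ i]) (auto simp: axis_def intro!: sum.cong)
  moreover have "(\<Sum>k\<in>UNIV. \<bar>x $ k\<bar> powr p) = \<bar>x $ i\<bar> powr p + (\<Sum>k\<in>UNIV - {i}. \<bar>x $ k\<bar> powr p)"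
    by (subst sum.remove[of _ i]) auto
  ultimately show ?thesis by simp
qed

lemma exists_diagonal_parameter:
  fixes p d :: real
  assumes "1 \<le> p" "1 \<le> d"
  obtains u where "0 < u" "(1 + u) powr p + (d - 1) * u powr p = 2"
proof -
  let ?f = "\<lambda>u::real. (1 + u) powr p + (d - 1) * u powr p"
  have "2 powr 1 \<le> (2::real) powr p" using assms by (intro powr_mono) auto
  then have "?f 0 \<le> 2" "2 \<le> ?f 1" using assms by auto
  moreover have "continuous_on {0..1} ?f"
    using assms by (intro continuous_on_powr' continuous_on_add continuous_on_diff continuous_on_mult
        continuous_on_const continuous_on_id) auto
  ultimately obtain u where u: "0 \<le> u" "?f u = 2"
    using IVT'[of ?f 0 2 1] by auto
  from u have "u \<noteq> 0" by auto
  with u show ?thesis using that[of u] by simp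
qed

text \<open>
  For \<open>p = 1\<close> the distance from \<open>x\<close> to \<open>e\<^sub>i\<close> is \<open>\<parallel>x\<parallel> + 1\<close> if \<open>x\<^sub>i \<le> 0\<close> and less otherwise. So either no
  coordinate is positive and \<open>\<parallel>x\<parallel> = 1\<close>, or all are positive. In the first case the distance from \<open>x\<close> to
  \<open>c = (-1/d, \<dots>, -1/d)\<close> equals \<open>\<parallel>x\<parallel> + \<parallel>c\<parallel>\<close>, which requires disjoint supports although \<open>c\<close> has full
  support. In the second case it equals \<open>\<parallel>x\<parallel> + 1\<close>, so \<open>\<parallel>x\<parallel> = 1\<close> and the distance to \<open>e\<^sub>i\<close> is less
  than \<open>2\<close>.
\<close>

lemma no_extension_p1:
  fixes x :: "real ^ 'n::finite"
  assumes u: "0 < u" "(1 + u) + (real CARD('n) - 1) * u = 2"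
    and ax: "\<And>i. \<bar>1 - x $ i\<bar> - \<bar>x $ i\<bar> + (\<Sum>k\<in>UNIV. \<bar>x $ k\<bar>) = 2"
    and diag: "(\<Sum>k\<in>UNIV. \<bar>u + x $ k\<bar>) = 2"
  shows False
proof -
  have du: "(\<Sum>k\<in>(UNIV::'n set). u) = 1" using u by (simp add: algebra_simps)
  show False
  proof (cases "\<exists>i. x $ i \<le> 0")
    case True
    then obtain i where "x $ i \<le> 0" by blast
    then have norm: "(\<Sum>k\<in>UNIV. \<bar>x $ k\<bar>) = 1" using ax[of i] by simp
    then have neg: "x $ i \<le> 0" for i using ax[of i] by (auto simp: abs_if split: if_splits)
    \<comment> \<open>The triangle inequality is an equality in every coordinate, where the two signs are opposite.\<close>
    have "(\<Sum>k\<in>UNIV. u + \<bar>x $ k\<bar> - \<bar>u + x $ k\<bar>) = 0"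
      using diag norm du by (simp add: sum.distrib sum_subtractf)
    then have "u + \<bar>x $ k\<bar> - \<bar>u + x $ k\<bar> = 0" for k
      using u by (subst (asm) sum_nonneg_eq_0_iff) auto
    then have "x $ k = 0" for k using neg[of k] u(1) by (smt (verit))
    then show False using norm by simp
  next
    case False
    then have "\<bar>u + x $ k\<bar> = u + \<bar>x $ k\<bar>" for k
      using u(1) by (smt (verit))
    then have "(\<Sum>k\<in>UNIV. u + \<bar>x $ k\<bar>) = 2"
      using diag by simp
    then have "(\<Sum>k\<in>UNIV. \<bar>x $ k\<bar>) = 1" using du by (simp add: sum.distrib)
    then have "\<bar>1 - x $ undefined\<bar> = 1 + \<bar>x $ undefined\<bar>" using ax[of undefined] by simp
    moreover have "0 < x $ undefined" using False by (auto simp: not_le)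
    ultimately show False by linarith
  qed
qed

lemma no_extension_p_gt_1:
  fixes x :: "real ^ 'n::finite"
  assumes p: "1 < p"
    and u: "0 < u" "(1 + u) powr p + (real CARD('n) - 1) * u powr p = 2"
    and ax: "\<And>i. \<bar>1 - x $ i\<bar> powr p - \<bar>x $ i\<bar> powr p + (\<Sum>k\<in>UNIV. \<bar>x $ k\<bar> powr p) = 2"
    and diag: "(\<Sum>k\<in>UNIV. \<bar>u + x $ k\<bar> powr p) = 2"
  shows False
proof -
  define t where "t = x $ undefined"
  have x: "x $ i = t" for i
    unfolding t_def
  proof (rule diagonal_distance_inj[OF p])
    show "\<bar>1 - x $ i\<bar> powr p - \<bar>x $ i\<bar> powr p
        = \<bar>1 - x $ undefined\<bar> powr p - \<bar>x $ undefined\<bar> powr p"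
      using ax[of i] ax[of undefined] by linarith
  qed
  have d: "1 \<le> real CARD('n)" by (simp add: Suc_leI)
  have ft: "\<bar>1 - t\<bar> powr p + (real CARD('n) - 1) * \<bar>t\<bar> powr p = 2"
    using ax by (simp add: x algebra_simps)
  have dt: "real CARD('n) * \<bar>u + t\<bar> powr p = 2"
    using diag by (simp add: x)
  \<comment> \<open>Strict monotonicity of the function defining \<open>u\<close> leaves \<open>t = -u\<close> as the only non-positive candidate.\<close>
  let ?g = "\<lambda>s. (1 + s) powr p + (real CARD('n) - 1) * s powr p"
  have g_less: "?g s < ?g s'" if "0 \<le> s" "s < s'" for s s'
  proof (rule add_less_le_mono)
    show "(1 + s) powr p < (1 + s') powr p"
      using that p by (intro powr_less_mono2) auto
    show "(real CARD('n) - 1) * s powr p \<le> (real CARD('n) - 1) * s' powr p"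
      using that p d by (intro mult_left_mono powr_mono2) auto
  qed
  consider "0 < t" | "t \<le> 0" "u = - t" | "t \<le> 0" "u < - t" | "t \<le> 0" "- t < u" by linarith
  then show False
  proof cases
    case 1
    then show False using diagonal_gap[OF p d u(1) 1 u(2)] ft dt 1 u(1) by simp
  next
    case 2
    then show False using dt by simp
  next
    case 3
    then show False using g_less[of u "- t"] u ft by simp
  next
    case 4
    then show False using g_less[of "- t" u] u ft by simp
  qed
qed

lemma exists_small_maximal_equilateral:
  fixes p :: real
  assumes p: "1 \<le> p"
  shows "\<exists>A :: (real ^ 'n::finite) set. maximal_equilateral (lp_norm p) A
    \<and> finite A \<and> card A \<le> CARD('n) + 1"
proof -
  let ?N = "lp_norm p :: real ^ 'n \<Rightarrow> real"
  have "1 \<le> real CARD('n)" by (simp add: Suc_leI)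
  then obtain u where u: "0 < u" "(1 + u) powr p + (real CARD('n) - 1) * u powr p = 2"
    using exists_diagonal_parameter[OF p] by blast
  define c :: "real ^ 'n" where "c = vec (- u)"
  define E :: "(real ^ 'n) set" where "E = range (\<lambda>i. axis i 1)"
  define l :: real where "l = 2 powr (1 / p)"
  have c_nth: "c $ i = - u" for i by (simp add: c_def)
  have sym: "?N (x - y) = ?N (y - x)" for x y
    by (simp add: lp_norm_def abs_minus_commute)
  have ax_c: "?N (axis i 1 - c) = l" for i
    unfolding l_def lp_norm_eq_iff[OF p] sum_powr_axis_diff
    using u by (simp add: c_nth algebra_simps)
  have ax_ax: "?N (axis i 1 - axis j 1) = l" if "i \<noteq> j" for i j :: 'n
  proof -
    have "(\<Sum>k\<in>UNIV. \<bar>(axis j 1 :: real ^ 'n) $ k\<bar> powr p) = (\<Sum>k\<in>UNIV. if k = j then 1 else 0)"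
      by (intro sum.cong) (auto simp: axis_def)
    then show ?thesis unfolding l_def lp_norm_eq_iff[OF p] sum_powr_axis_diff
      using that by (simp add: axis_def)
  qed
  have "lambda_equilateral ?N l (insert c E)"
    unfolding lambda_equilateral_def E_def
  proof (intro ballI impI)
    fix x y :: "real ^ 'n"
    assume xy: "x \<in> insert c (range (\<lambda>i. axis i 1))" "y \<in> insert c (range (\<lambda>i. axis i 1))" "x \<noteq> y"
    then consider "x = c" "y = c" | i where "x = axis i 1" "y = c" | i where "x = c" "y = axis i 1"
      | i j where "x = axis i 1" "y = axis j 1" by auto
    then show "?N (x - y) = l"
    proof cases
      case 1
      then show ?thesis using xy(3) by simp
    next
      case 2
      then show ?thesis using ax_c by simp
    next
      case 3
      then show ?thesis using ax_c sym[of x y] by simp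
    next
      case (4 i j)
      then show ?thesis using ax_ax[of i j] xy(3) by auto
    qed
  qed
  moreover have "0 < l" by (simp add: l_def)
  ultimately have eq: "equilateral ?N (insert c E)" unfolding equilateral_def by blast
  have no_ext: "x \<in> insert c E"
    if A': "lambda_equilateral ?N l' A'" "insert c E \<subseteq> A'" "x \<in> A'" for l' A' x
  proof (rule ccontr)
    assume x: "x \<notin> insert c E"
    have c_ne: "axis i 1 \<noteq> c" for i :: 'n
    proof
      assume "axis i 1 = c"
      then have "axis i 1 $ i = c $ i" by simp
      then show False using u by (simp add: c_nth)
    qed
    have "axis undefined 1 \<in> A'" "c \<in> A'" using A' by (auto simp: E_def)
    then have l': "l' = l"
      using A'(1) c_ne[of undefined] ax_c[of undefined] unfolding lambda_equilateral_def by auto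
    have dist: "?N (a - x) = l" if "a \<in> insert c E" for a
    proof -
      have "a \<in> A'" "a \<noteq> x" using that A'(2) x by auto
      then show ?thesis using A'(1,3) l' unfolding lambda_equilateral_def by simp
    qed
    have "?N (axis i 1 - x) = l" for i
      by (rule dist) (simp add: E_def)
    then have ax: "\<bar>1 - x $ i\<bar> powr p - \<bar>x $ i\<bar> powr p + (\<Sum>k\<in>UNIV. \<bar>x $ k\<bar> powr p) = 2" for i
      unfolding l_def lp_norm_eq_iff[OF p] sum_powr_axis_diff by simp
    have "?N (x - c) = l"
      using dist[of c] sym[of x c] by simp
    then have diag: "(\<Sum>k\<in>UNIV. \<bar>u + x $ k\<bar> powr p) = 2"
      unfolding l_def lp_norm_eq_iff[OF p] by (simp add: c_nth add.commute)
    show False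
    proof (cases "p = 1")
      case True
      then show False using no_extension_p1[of u x] u ax diag by simp
    next
      case False
      then show False using no_extension_p_gt_1[of p u x] p u ax diag by simp
    qed
  qed
  have "\<not> (\<exists>A'. equilateral ?N A' \<and> insert c E \<subset> A')"
    unfolding equilateral_def using no_ext by blast
  moreover have "card E \<le> CARD('n)" "finite E" unfolding E_def by (auto intro: card_image_le)
  then have "card (insert c E) \<le> CARD('n) + 1" by (simp add: card_insert_if)
  ultimately show ?thesis using eq \<open>finite E\<close> unfolding maximal_equilateral_def by blast
qed

theorem theorem4:
  fixes p :: real
  assumes "1 \<le> p"
  shows "min_maximal_equilateral (lp_norm p :: real ^ 'n::finite \<Rightarrow> real) \<le> enat (CARD('n) + 1)"
proof -
  obtain A :: "(real ^ 'n) set" where A: "maximal_equilateral (lp_norm p) A"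
    "finite A" "card A \<le> CARD('n) + 1"
    using exists_small_maximal_equilateral[OF assms] by blast
  have "min_maximal_equilateral (lp_norm p :: real ^ 'n \<Rightarrow> real) \<le> ecard A"
    unfolding min_maximal_equilateral_def using A(1) by (intro INF_lower) simp
  also have "\<dots> \<le> enat (CARD('n) + 1)" using A by (simp add: ecard_def)
  finally show ?thesis .
qed

end
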